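(* Let $\gamma$ be a modulus function. Then every countable subset of $\mathbb{R}$ is closed in the $\gamma$-density topology $\tau_\gamma$. Consequently, $(\mathbb{R},\tau_\gamma)$ is not separable, and every compact subset of $(\mathbb{R},\tau_\gamma)$ is finite.
   Context: $|\cdot|$ denotes Lebesgue measure on $\mathbb{R}$, $\mathcal{L}$ the family of Lebesgue measurable subsets of $\mathbb{R}$, and $A^c=\mathbb{R}\setminus A$. A modulus function is a function $\gamma:[0,\infty)\to[0,\infty)$ such that (i) $\gamma(a)=0\Leftrightarrow a=0$; (ii) $\gamma(a+b)\le\gamma(a)+\gamma(b)$ for all $a,b\ge 0$; (iii) $\gamma$ is right-continuous at $0$; (iv) $\gamma$ is increasing (in the weak sense: $a\le b$ implies $\gamma(a)\le\gamma(b)$). For $A\in\mathcal{L}$, $\mathcal{D}_\gamma(A)$ is the set of all $x\in\mathbb{R}$ with $\lim_{\alpha\to 0^+}\frac{\gamma(|(x-\alpha,x+\alpha)\cap A^c|)}{\gamma(2\alpha)}=0$. The $\gamma$-density (modulus density) topology on $\mathbb{R}$ is $\tau_\gamma=\{A\in\mathcal{L}:A\subset\mathcal{D}_\gamma(A)\}$. *)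

theory Defs
  imports "HOL-Analysis.Analysis"
begin

text \<open>A function on \<open>[0,\<infinity>)\<close> is represented by a function on all reals whose values
  at negative arguments are unconstrained and never used below.\<close>

definition modulus_function :: "(real \<Rightarrow> real) \<Rightarrow> bool" where
  "modulus_function \<gamma> \<longleftrightarrow>
     (\<forall>a\<ge>0. 0 \<le> \<gamma> a) \<and>
     (\<forall>a\<ge>0. \<gamma> a = 0 \<longleftrightarrow> a = 0) \<and>
     (\<forall>a\<ge>0. \<forall>b\<ge>0. \<gamma> (a + b) \<le> \<gamma> a + \<gamma> b) \<and>
     continuous (at_right 0) \<gamma> \<and>
     mono_on {0..} \<gamma>"

definition density_points :: "(real \<Rightarrow> real) \<Rightarrow> real set \<Rightarrow> real set" where
  "density_points \<gamma> A =
     {x. ((\<lambda>\<alpha>. \<gamma> (measure lebesgue ({x - \<alpha><..<x + \<alpha>} \<inter> - A)) / \<gamma> (2 * \<alpha>)) \<longlongrightarrow> 0) (at_right 0)}"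

definition density_open :: "(real \<Rightarrow> real) \<Rightarrow> real set \<Rightarrow> bool" where
  "density_open \<gamma> A \<longleftrightarrow> A \<in> sets lebesgue \<and> A \<subseteq> density_points \<gamma> A"

text \<open>For a modulus function \<open>\<gamma>\<close> this is a genuine topology with carrier \<open>\<real>\<close>; see
  \<open>openin_density_topology\<close> and \<open>topspace_density_topology\<close> at the end.\<close>

definition density_topology :: "(real \<Rightarrow> real) \<Rightarrow> real topology" where
  "density_topology \<gamma> = topology (density_open \<gamma>)"

lemma modulus_functionD:
  assumes "modulus_function \<gamma>"
  shows "\<And>a. 0 \<le> a \<Longrightarrow> 0 \<le> \<gamma> a"
    and "\<And>a. 0 \<le> a \<Longrightarrow> \<gamma> a = 0 \<longleftrightarrow> a = 0"
    and "\<And>a b. 0 \<le> a \<Longrightarrow> 0 \<le> b \<Longrightarrow> \<gamma> (a + b) \<le> \<gamma> a + \<gamma> b"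
    and "\<And>a b. 0 \<le> a \<Longrightarrow> a \<le> b \<Longrightarrow> \<gamma> a \<le> \<gamma> b"
    and "\<And>a. 0 < a \<Longrightarrow> 0 < \<gamma> a"
  using assms unfolding modulus_function_def mono_on_def
  by (auto simp: order_less_le)

lemma modulus_mult_le:
  assumes "modulus_function \<gamma>" "0 \<le> a"
  shows "\<gamma> (real n * a) \<le> real n * \<gamma> a"
proof (induction n)
  case 0
  then show ?case using modulus_functionD(2)[OF assms(1), of 0] by simp
next
  case (Suc n)
  have "\<gamma> (a + real n * a) \<le> \<gamma> a + \<gamma> (real n * a)"
    using assms by (intro modulus_functionD(3)) auto
  with Suc show ?case by (simp add: algebra_simps)
qed

lemma lmeasurable_interval_Int:
  fixes a b :: real
  assumes "A \<in> sets lebesgue"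
  shows "{a<..<b} \<inter> A \<in> lmeasurable"
  using assms by (intro bounded_set_imp_lmeasurable) auto

lemma density_pointsD:
  assumes g: "modulus_function \<gamma>" and x: "x \<in> density_points \<gamma> A" and "0 < e"
  shows "\<forall>\<^sub>F d in at_right 0. measure lebesgue ({x - d<..<x + d} \<inter> - A) < e * (2 * d)"
proof -
  obtain n :: nat where n: "n > 0" "1 / real n < e"
    using \<open>0 < e\<close> by (metis nat_approx_posE zero_less_Suc)
  have "\<forall>\<^sub>F d in at_right 0.
      \<gamma> (measure lebesgue ({x - d<..<x + d} \<inter> - A)) / \<gamma> (2 * d) < 1 / real n"
    using x n unfolding density_points_def by (auto intro: order_tendstoD)
  moreover have "\<forall>\<^sub>F d in at_right (0::real). 0 < d"
    by (simp add: eventually_at_right_less)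
  ultimately show ?thesis
  proof eventually_elim
    case (elim d)
    let ?m = "measure lebesgue ({x - d<..<x + d} \<inter> - A)"
    show ?case
    proof (rule ccontr)
      assume "\<not> ?m < e * (2 * d)"
      moreover have "2 * d / real n \<le> e * (2 * d)"
        using mult_right_mono[of "1 / real n" e "2 * d"] n elim(2) by simp
      ultimately have "2 * d / real n \<le> ?m" by linarith
      then have "\<gamma> (2 * d / real n) \<le> \<gamma> ?m"
        using elim(2) by (intro modulus_functionD(4)[OF g]) auto
      moreover have "\<gamma> (2 * d) \<le> real n * \<gamma> (2 * d / real n)"
        using modulus_mult_le[OF g, of "2 * d / real n" n] n elim(2) by simp
      ultimately have "\<gamma> (2 * d) \<le> real n * \<gamma> ?m"
        by (meson mult_left_mono of_nat_0_le_iff order_trans)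
      moreover have "0 < \<gamma> (2 * d)"
        using elim(2) by (intro modulus_functionD(5)[OF g]) auto
      ultimately show False
        using elim(1) n by (simp add: field_simps)
    qed
  qed
qed

lemma ex_countable_essential_cover:
  fixes F :: "real set set"
  assumes F: "F \<subseteq> sets lebesgue"
  obtains C where "C \<subseteq> F" "countable C" "\<And>B. B \<in> F \<Longrightarrow> negligible (B - \<Union>C)"
proof -
  define I where "I n = {- real n..real n}" for n :: nat
  define K where "K = {C. C \<subseteq> F \<and> countable C}"
  define m where "m n C = measure lebesgue (\<Union>C \<inter> I n)" for n C
  define s where "s n = (SUP C\<in>K. m n C)" for n
  have meas: "\<Union>C \<in> sets lebesgue" if "C \<in> K" for C
    using that F unfolding K_def by (auto intro!: sets.countable_Union)
  have lm: "A \<inter> I n \<in> lmeasurable" if "A \<in> sets lebesgue" for A n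
    using that unfolding I_def
    by (intro bounded_set_imp_lmeasurable) (auto intro: bounded_subset)
  have bd: "bdd_above (m n ` K)" for n
  proof (rule bdd_aboveI2)
    fix C assume "C \<in> K"
    then show "m n C \<le> measure lebesgue (I n)"
      unfolding m_def by (intro measure_mono_fmeasurable) (auto simp: I_def intro!: sets.Int meas)
  qed
  have mono: "m n C \<le> m n C'" if "C \<subseteq> C'" "C \<in> K" "C' \<in> K" for n C C'
    using that unfolding m_def
    by (intro measure_mono_fmeasurable lm meas fmeasurableD[OF lm]) auto
  have "\<exists>C\<in>K. s n - 1 / real (Suc k) < m n C" for n k
  proof -
    have "K \<noteq> {}" unfolding K_def by auto
    moreover have "s n - 1 / real (Suc k) < (SUP C\<in>K. m n C)" unfolding s_def by simp
    ultimately show ?thesis using less_cSUP_iff[OF _ bd] by metis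
  qed
  then obtain c where c: "\<And>n k. c n k \<in> K" "\<And>n k. s n - 1 / real (Suc k) < m n (c n k)"
    by metis
  define C where "C = (\<Union>n k. c n k)"
  have CK: "C \<in> K" using c(1) unfolding C_def K_def by fast
  have ge: "s n \<le> m n C" for n
  proof (rule field_le_epsilon)
    fix e :: real assume "0 < e"
    then obtain k where "1 / real (Suc k) < e" using nat_approx_posE by blast
    moreover have "m n (c n k) \<le> m n C"
      using c(1) CK by (intro mono) (auto simp: C_def)
    ultimately show "s n \<le> m n C + e" using c(2)[of n k] by linarith
  qed
  show ?thesis
  proof (rule that[of C])
    show "C \<subseteq> F" "countable C" using CK by (auto simp: K_def)
  next
    fix B assume B: "B \<in> F"
    have nn: "negligible ((B - \<Union>C) \<inter> I n)" for n
    proof -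
      have iK: "insert B C \<in> K" using CK B by (auto simp: K_def)
      have Bm: "B - \<Union>C \<in> sets lebesgue" using B F meas[OF CK] by auto
      have "m n (insert B C) = m n C + measure lebesgue ((B - \<Union>C) \<inter> I n)"
      proof -
        have "\<Union>(insert B C) \<inter> I n = (\<Union>C \<inter> I n) \<union> ((B - \<Union>C) \<inter> I n)" by auto
        moreover have "(\<Union>C \<inter> I n) \<inter> ((B - \<Union>C) \<inter> I n) = {}" by auto
        ultimately show ?thesis
          unfolding m_def
          using measure_Un3[OF lm[OF meas[OF CK], of n] lm[OF Bm, of n]] by simp
      qed
      moreover have "m n (insert B C) \<le> s n"
        unfolding s_def using iK bd by (rule cSUP_upper)
      ultimately have "measure lebesgue ((B - \<Union>C) \<inter> I n) = 0"
        using ge[of n] measure_nonneg[of lebesgue "(B - \<Union>C) \<inter> I n"] by linarith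
      then show ?thesis using lm[OF Bm] by (simp add: negligible_iff_measure)
    qed
    have "B - \<Union>C = (\<Union>n. (B - \<Union>C) \<inter> I n)"
    proof -
      have "\<exists>n. x \<in> I n" for x
        unfolding I_def using real_arch_simple[of "\<bar>x\<bar>"] by (auto simp: abs_le_iff minus_le_iff)
      then show ?thesis by auto
    qed
    then show "negligible (B - \<Union>C)" using negligible_countable_Union[of "range (\<lambda>n. (B - \<Union>C) \<inter> I n)"] nn
      by auto
  qed
qed

lemma density_points_mono:
  assumes g: "modulus_function \<gamma>" and "A \<subseteq> B" "A \<in> sets lebesgue" "B \<in> sets lebesgue"
  shows "density_points \<gamma> A \<subseteq> density_points \<gamma> B"
proof
  fix x assume "x \<in> density_points \<gamma> A"
  then have lim: "((\<lambda>d. \<gamma> (measure lebesgue ({x - d<..<x + d} \<inter> - A)) / \<gamma> (2 * d)) \<longlongrightarrow> 0) (at_right 0)"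
    by (simp add: density_points_def)
  have pos: "\<forall>\<^sub>F d in at_right (0::real). 0 < d"
    by (simp add: eventually_at_right_less)
  have *: "\<gamma> (measure lebesgue ({x - d<..<x + d} \<inter> - B)) \<le> \<gamma> (measure lebesgue ({x - d<..<x + d} \<inter> - A))" for d
    using assms by (intro modulus_functionD(4)[OF g] measure_mono_fmeasurable
        lmeasurable_interval_Int fmeasurableD[OF lmeasurable_interval_Int]) (auto simp: Compl_in_sets_lebesgue)
  have "\<forall>\<^sub>F d in at_right 0. norm (\<gamma> (measure lebesgue ({x - d<..<x + d} \<inter> - B)) / \<gamma> (2 * d))
      \<le> \<gamma> (measure lebesgue ({x - d<..<x + d} \<inter> - A)) / \<gamma> (2 * d)"
    using pos
  proof eventually_elim
    case (elim d)
    have "0 \<le> \<gamma> (measure lebesgue ({x - d<..<x + d} \<inter> - B))" "0 \<le> \<gamma> (2 * d)"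
      using elim g by (auto simp: modulus_functionD(1))
    then show ?case
      using divide_right_mono[OF *[of d]] by simp
  qed
  then show "x \<in> density_points \<gamma> B"
    unfolding density_points_def mem_Collect_eq using lim by (rule Lim_null_comparison)
qed

lemma density_points_Int:
  assumes g: "modulus_function \<gamma>" and A: "A \<in> sets lebesgue" and B: "B \<in> sets lebesgue"
  shows "density_points \<gamma> A \<inter> density_points \<gamma> B \<subseteq> density_points \<gamma> (A \<inter> B)"
proof
  fix x assume x: "x \<in> density_points \<gamma> A \<inter> density_points \<gamma> B"
  define f where "f S d = measure lebesgue ({x - d<..<x + d} \<inter> - S)" for S d
  have lim: "((\<lambda>d. \<gamma> (f A d) / \<gamma> (2 * d) + \<gamma> (f B d) / \<gamma> (2 * d)) \<longlongrightarrow> 0) (at_right 0)"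
    using x unfolding density_points_def f_def by (auto intro: tendsto_add_zero)
  have pos: "\<forall>\<^sub>F d in at_right (0::real). 0 < d"
    by (simp add: eventually_at_right_less)
  have *: "\<gamma> (f (A \<inter> B) d) \<le> \<gamma> (f A d) + \<gamma> (f B d)" for d
  proof -
    have "f (A \<inter> B) d = measure lebesgue (({x - d<..<x + d} \<inter> - A) \<union> ({x - d<..<x + d} \<inter> - B))"
      unfolding f_def by (rule arg_cong[where f="measure lebesgue"]) auto
    also have "\<dots> \<le> f A d + f B d"
      unfolding f_def using A B
      by (intro measure_Un_le fmeasurableD[OF lmeasurable_interval_Int]) (auto simp: Compl_in_sets_lebesgue)
    finally have "\<gamma> (f (A \<inter> B) d) \<le> \<gamma> (f A d + f B d)"
      by (intro modulus_functionD(4)[OF g]) (auto simp: f_def)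
    also have "\<dots> \<le> \<gamma> (f A d) + \<gamma> (f B d)"
      by (intro modulus_functionD(3)[OF g]) (auto simp: f_def)
    finally show ?thesis .
  qed
  have "\<forall>\<^sub>F d in at_right 0. norm (\<gamma> (f (A \<inter> B) d) / \<gamma> (2 * d))
      \<le> \<gamma> (f A d) / \<gamma> (2 * d) + \<gamma> (f B d) / \<gamma> (2 * d)"
    using pos
  proof eventually_elim
    case (elim d)
    have "0 \<le> \<gamma> (f (A \<inter> B) d)" "0 \<le> \<gamma> (2 * d)"
      using elim g by (auto simp: f_def modulus_functionD(1))
    then show ?case
      using divide_right_mono[OF *[of d]] by (simp add: add_divide_distrib)
  qed
  then show "x \<in> density_points \<gamma> (A \<inter> B)"
    unfolding density_points_def f_def[symmetric] mem_Collect_eq using lim by (rule Lim_null_comparison)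
qed

lemma Union_density_open_measurable:
  assumes g: "modulus_function \<gamma>" and F: "\<And>A. A \<in> F \<Longrightarrow> density_open \<gamma> A"
  shows "\<Union>F \<in> sets lebesgue"
proof -
  have FL: "F \<subseteq> sets lebesgue" using F by (auto simp: density_open_def)
  then obtain C where C: "C \<subseteq> F" "countable C" "\<And>B. B \<in> F \<Longrightarrow> negligible (B - \<Union>C)"
    using ex_countable_essential_cover by metis
  have Cm: "\<Union>C \<in> sets lebesgue" using C FL by (auto intro!: sets.countable_Union)
  have "negligible (\<Union>F - \<Union>C)"
    unfolding negligible_eq_zero_density
  proof (intro ballI allI impI)
    fix x r e :: real assume x: "x \<in> \<Union>F - \<Union>C" and r: "0 < r" and e: "0 < e"
    then obtain B where B: "B \<in> F" "x \<in> B" by auto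
    have Bm: "B \<in> sets lebesgue" using B FL by auto
    have "x \<in> density_points \<gamma> B" using F B by (auto simp: density_open_def)
    from density_pointsD[OF g this e]
    have "\<forall>\<^sub>F d in at_right 0. measure lebesgue ({x - d<..<x + d} \<inter> - B) < e * (2 * d)" .
    moreover have "\<forall>\<^sub>F d in at_right (0::real). 0 < d \<and> d < r"
      using r by (auto simp: eventually_at_right_field)
    ultimately have "\<forall>\<^sub>F d in at_right 0.
        measure lebesgue ({x - d<..<x + d} \<inter> - B) < e * (2 * d) \<and> 0 < d \<and> d < r"
      by eventually_elim auto
    then obtain d where d: "0 < d" "d < r"
      "measure lebesgue ({x - d<..<x + d} \<inter> - B) < e * (2 * d)"
      by (metis (mono_tags, lifting) eventually_happens trivial_limit_at_right_real)
    define U where "U = {x - d<..<x + d} \<inter> - \<Union>C"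
    have Um: "U \<in> lmeasurable"
      unfolding U_def using Cm by (intro lmeasurable_interval_Int) (simp add: Compl_in_sets_lebesgue)
    have "measure lebesgue U \<le> measure lebesgue (({x - d<..<x + d} \<inter> - B) \<union> (B - \<Union>C))"
    proof (rule measure_mono_fmeasurable)
      show "U \<subseteq> {x - d<..<x + d} \<inter> - B \<union> (B - \<Union> C)" by (auto simp: U_def)
      show "U \<in> sets lebesgue" using Um by auto
      show "{x - d<..<x + d} \<inter> - B \<union> (B - \<Union> C) \<in> lmeasurable"
        using Bm C(3)[OF B(1)]
        by (intro fmeasurable.Un lmeasurable_interval_Int negligible_imp_measurable)
          (auto simp: Compl_in_sets_lebesgue)
    qed
    also have "\<dots> \<le> measure lebesgue ({x - d<..<x + d} \<inter> - B) + measure lebesgue (B - \<Union>C)"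
      using Bm Cm by (intro measure_Un_le fmeasurableD[OF lmeasurable_interval_Int])
        (auto simp: Compl_in_sets_lebesgue)
    also have "measure lebesgue (B - \<Union>C) = 0"
      using C(3)[OF B(1)] by (rule negligible_imp_measure0)
    finally have "measure lebesgue U < e * measure lebesgue (ball x d)"
      using d by (simp add: ball_eq_greaterThanLessThan)
    moreover have "(\<Union>F - \<Union>C) \<inter> ball x d \<subseteq> U"
      by (auto simp: U_def ball_eq_greaterThanLessThan)
    ultimately show "\<exists>d>0. d \<le> r \<and> (\<exists>U. (\<Union>F - \<Union>C) \<inter> ball x d \<subseteq> U \<and> U \<in> lmeasurable \<and>
        measure lebesgue U < e * measure lebesgue (ball x d))"
      using d Um by (meson less_imp_le)
  qed
  then have "\<Union>F - \<Union>C \<in> sets lebesgue" by (rule negligible_imp_sets)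
  then have "\<Union>C \<union> (\<Union>F - \<Union>C) \<in> sets lebesgue" using Cm by (rule sets.Un[rotated])
  moreover have "\<Union>C \<union> (\<Union>F - \<Union>C) = \<Union>F" using C(1) by auto
  ultimately show ?thesis by simp
qed

lemma istopology_density_open:
  assumes g: "modulus_function \<gamma>"
  shows "istopology (density_open \<gamma>)"
  unfolding istopology_def
proof (intro conjI allI impI)
  fix S T assume "density_open \<gamma> S" "density_open \<gamma> T"
  then show "density_open \<gamma> (S \<inter> T)"
    using density_points_Int[OF g, of S T] by (auto simp: density_open_def)
next
  fix F assume F: "\<forall>A\<in>F. density_open \<gamma> A"
  then have m: "\<Union>F \<in> sets lebesgue" by (intro Union_density_open_measurable[OF g]) auto
  moreover have "A \<subseteq> density_points \<gamma> (\<Union>F)" if "A \<in> F" for A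
    using density_points_mono[OF g, of A "\<Union>F"] F that m by (auto simp: density_open_def)
  ultimately show "density_open \<gamma> (\<Union>F)" by (auto simp: density_open_def)
qed

lemma openin_density_topology:
  assumes "modulus_function \<gamma>"
  shows "openin (density_topology \<gamma>) A \<longleftrightarrow> A \<in> sets lebesgue \<and> A \<subseteq> density_points \<gamma> A"
  by (simp add: density_topology_def topology_inverse'[OF istopology_density_open[OF assms]]
      density_open_def)

lemma topspace_density_topology:
  assumes "modulus_function \<gamma>"
  shows "topspace (density_topology \<gamma>) = UNIV"
proof -
  have "density_points \<gamma> UNIV = UNIV"
    using modulus_functionD(2)[OF assms, of 0] by (simp add: density_points_def)
  then have "openin (density_topology \<gamma>) UNIV"
    by (simp add: openin_density_topology[OF assms])
  then show ?thesis by (simp add: openin_subset top.extremum_uniqueI)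
qed

end

theory Submission
  imports Defs
begin

text \<open>A countable set is Lebesgue null. The density condition at \<open>x\<close> only sees the measure of
  the part of the complement that lies near \<open>x\<close>, so a set with null complement has density
  quotient \<open>\<gamma> 0 / \<gamma> (2 * \<alpha>) = 0\<close> at every point. Hence null sets are closed, and in particular
  countable sets are.

  Both consequences are purely topological once countable sets are known to be closed. A
  countable dense set equals its closure, which is the uncountable line. An infinite compact set
  would contain a countably infinite set; that set is closed, hence compact, and discrete because
  all of its subsets are closed too, which is impossible.\<close>

lemma closedin_density_topology_negligible:
  assumes g: "modulus_function \<gamma>" and N: "negligible N"
  shows "closedin (density_topology \<gamma>) N"
proof -
  have "measure lebesgue ({x - \<alpha><..<x + \<alpha>} \<inter> N) = 0" for x \<alpha> :: real
    using N by (intro negligible_imp_measure0 negligible_Int) auto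
  moreover have "\<gamma> 0 = 0"
    using modulus_functionD(2)[OF g, of 0] by simp
  ultimately have "density_points \<gamma> (- N) = UNIV"
    by (simp add: density_points_def)
  moreover have "- N \<in> sets lebesgue"
    using negligible_imp_sets[OF N] by (simp add: Compl_in_sets_lebesgue)
  ultimately have "openin (density_topology \<gamma>) (- N)"
    by (simp add: openin_density_topology[OF g])
  then show ?thesis
    by (simp add: closedin_def topspace_density_topology[OF g] Compl_eq_Diff_UNIV)
qed

lemma separable_space_imp_countable_topspace:
  assumes closed: "\<And>C. countable C \<Longrightarrow> C \<subseteq> topspace X \<Longrightarrow> closedin X C"
    and "separable_space X"
  shows "countable (topspace X)"
proof -
  obtain C where "countable C" "C \<subseteq> topspace X" "X closure_of C = topspace X"
    using \<open>separable_space X\<close> by (auto simp: separable_space_def)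
  then show ?thesis
    using closure_of_closedin[OF closed] by metis
qed

lemma compactin_imp_finite_of_countable_closed:
  assumes closed: "\<And>C. countable C \<Longrightarrow> C \<subseteq> topspace X \<Longrightarrow> closedin X C"
    and K: "compactin X K"
  shows "finite K"
proof (rule ccontr)
  assume "infinite K"
  then obtain D where D: "D \<subseteq> K" "countable D" "infinite D"
    using infinite_countable_subset' by blast
  have DX: "D \<subseteq> topspace X"
    using D compactin_subset_topspace[OF K] by blast
  have "compactin X D"
    using closed_compactin[OF K D(1) closed[OF D(2) DX]] .
  \<comment> \<open>Subsets of \<open>D\<close> are again countable, so complements of points in \<open>D\<close> are closed.\<close>
  moreover have "subtopology X D = discrete_topology D"
  proof -
    have "closedin (subtopology X D) C" if "C \<subseteq> D" for C
      using that D(2) DX by (intro closedin_subset_topspace closed) (auto intro: countable_subset)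
    then have "openin (subtopology X D) (D - C)" if "C \<subseteq> D" for C
      using that DX by (auto simp: closedin_def Int_absorb1 Int_absorb2)
    then have "openin (subtopology X D) {x}" if "x \<in> D" for x
      using that by (metis Diff_subset double_diff empty_subsetI insert_subset order_refl)
    then show ?thesis
      using DX by (intro sym[OF iffD2[OF discrete_topology_unique]]) (auto simp: Int_absorb1)
  qed
  ultimately show False
    using D(3) by (simp add: compactin_subspace compact_space_discrete_topology)
qed

theorem theorem12:
  fixes \<gamma> :: "real \<Rightarrow> real"
  assumes "modulus_function \<gamma>"
  shows "(\<forall>C. countable C \<longrightarrow> closedin (density_topology \<gamma>) C) \<and>
         \<not> separable_space (density_topology \<gamma>) \<and>
         (\<forall>K. compactin (density_topology \<gamma>) K \<longrightarrow> finite K)"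
proof -
  have closed: "closedin (density_topology \<gamma>) C" if "countable C" for C
  proof -
    have "negligible C"
      using countable_imp_null_set_lborel[OF that]
      by (simp add: negligible_iff_null_sets null_sets_completionI)
    then show ?thesis
      by (rule closedin_density_topology_negligible[OF assms])
  qed
  moreover have "\<not> separable_space (density_topology \<gamma>)"
    using separable_space_imp_countable_topspace[of "density_topology \<gamma>"] closed
      uncountable_UNIV_real topspace_density_topology[OF assms] by metis
  moreover have "finite K" if "compactin (density_topology \<gamma>) K" for K
    using compactin_imp_finite_of_countable_closed[OF closed that] .
  ultimately show ?thesis
    by blast
qed

end
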